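(* Let $M$ be a finite monoid. Then there exists a sequence of monoids $M_1,\ldots,M_k=M$ with $k\le 2^{|M|}-1$ such that for each $1\le j\le k$ one of the following holds: - $M_j$ is a group which is a divisor of $M$; - $M_j$ is a divisor of a local Rees product $\mathrm{LocRees}(M_i,M_\ell)$ with $i,\ell<j$, where $M_i$ is a proper submonoid of $M_j$ and $M_\ell$ is the local divisor of $M_j$ at some non-unit $c\in M_j$.
   Context: A monoid $N$ is a divisor of a monoid $M$ if $N$ is a homomorphic image of a subsemigroup of $M$. For a finite monoid $M$ and $c\in M$, the local divisor of $M$ at $c$ is the monoid $M_c=(cM\cap Mc,\circ,c)$ with neutral element $c$ and multiplication $mc\circ cn=mcn$. For monoids $N,L$ and any mapping $\rho:N\to L$, the Rees extension $\mathrm{Rees}(N,L,\rho)$ is the set $N\cup (N\times L\times N)$ with multiplication: $n\cdot n'=nn'$; $n\cdot(n_1,m,n_2)\cdot n'=(nn_1,m,n_2n')$; $(n_1,m,n_2)\cdot(n_1',m',n_2')=(n_1,m\,\rho(n_2n_1')\,m',n_2')$, for $n,n',n_1,n_2,n_1',n_2'\in N$, $m,m'\in L$. If $N$ is a proper submonoid of a finite monoid $M$ and $c\in M$ is not a unit, the local Rees product is $\mathrm{LocRees}(N,M_c)=\mathrm{Rees}(N,M_c,\rho_c)$ with $\rho_c:N\to M_c$, $\rho_c(x)=cxc$. *)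

theory Defs
  imports "HOL-Algebra.Coset"
begin

definition subsemigroup :: "'a set \<Rightarrow> ('a, 'b) monoid_scheme \<Rightarrow> bool"
  where "subsemigroup S M \<longleftrightarrow>
    S \<subseteq> carrier M \<and> S \<noteq> {} \<and> (\<forall>x\<in>S. \<forall>y\<in>S. x \<otimes>\<^bsub>M\<^esub> y \<in> S)"

text \<open>
  The maps in \<^const>\<open>hom\<close> respect the multiplication only. This is what is needed here, since
  a subsemigroup need not contain the neutral element; the field \<open>one\<close> of the
  restricted record plays no role.
\<close>

definition is_divisor :: "('a, 'c) monoid_scheme \<Rightarrow> ('b, 'd) monoid_scheme \<Rightarrow> bool"
  where "is_divisor N M \<longleftrightarrow>
    (\<exists>S h. subsemigroup S M \<and> h \<in> epi (M\<lparr>carrier := S\<rparr>) N)"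

definition proper_submonoid :: "'a monoid \<Rightarrow> 'a monoid \<Rightarrow> bool"
  where "proper_submonoid N M \<longleftrightarrow>
    (\<exists>H. submonoid H M \<and> H \<noteq> carrier M \<and> N = M\<lparr>carrier := H\<rparr>)"

text \<open>
  The product \<open>mc \<circ> cn = mcn\<close> depends only on the elements \<open>mc\<close> and \<open>cn\<close>, not on \<open>m\<close> and
  \<open>n\<close>, so the description below determines a unique element on the carrier
  (\<open>local_divisor_mult\<close>).
\<close>

definition local_divisor :: "'a monoid \<Rightarrow> 'a \<Rightarrow> 'a monoid"
  where "local_divisor M c =
    \<lparr>carrier = (c <#\<^bsub>M\<^esub> carrier M) \<inter> (carrier M #>\<^bsub>M\<^esub> c),
     mult = (\<lambda>x y. THE z. \<exists>m\<in>carrier M. \<exists>n\<in>carrier M.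
               x = m \<otimes>\<^bsub>M\<^esub> c \<and> y = c \<otimes>\<^bsub>M\<^esub> n \<and> z = m \<otimes>\<^bsub>M\<^esub> c \<otimes>\<^bsub>M\<^esub> n),
     one = c\<rparr>"

text \<open>
  The disjoint union of \<open>N\<close> and \<open>N \<times> L \<times> N\<close> is encoded by a sum type. The clauses for
  \<open>n \<cdot> (n\<^sub>1, m, n\<^sub>2)\<close> and \<open>(n\<^sub>1, m, n\<^sub>2) \<cdot> n'\<close> are the two halves of
  \<open>n \<cdot> (n\<^sub>1, m, n\<^sub>2) \<cdot> n' = (nn\<^sub>1, m, n\<^sub>2n')\<close>.
\<close>

fun rees_mult ::
  "'a monoid \<Rightarrow> 'b monoid \<Rightarrow> ('a \<Rightarrow> 'b) \<Rightarrow>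
   'a + ('a \<times> 'b \<times> 'a) \<Rightarrow> 'a + ('a \<times> 'b \<times> 'a) \<Rightarrow> 'a + ('a \<times> 'b \<times> 'a)"
  where
    "rees_mult N L \<rho> (Inl n) (Inl n') = Inl (n \<otimes>\<^bsub>N\<^esub> n')"
  | "rees_mult N L \<rho> (Inl n) (Inr (n1, m, n2)) = Inr (n \<otimes>\<^bsub>N\<^esub> n1, m, n2)"
  | "rees_mult N L \<rho> (Inr (n1, m, n2)) (Inl n') = Inr (n1, m, n2 \<otimes>\<^bsub>N\<^esub> n')"
  | "rees_mult N L \<rho> (Inr (n1, m, n2)) (Inr (n1', m', n2')) =
       Inr (n1, m \<otimes>\<^bsub>L\<^esub> \<rho> (n2 \<otimes>\<^bsub>N\<^esub> n1') \<otimes>\<^bsub>L\<^esub> m', n2')"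

definition rees_extension ::
  "'a monoid \<Rightarrow> 'b monoid \<Rightarrow> ('a \<Rightarrow> 'b) \<Rightarrow> ('a + ('a \<times> 'b \<times> 'a)) monoid"
  where "rees_extension N L \<rho> =
    \<lparr>carrier = Inl ` carrier N \<union> Inr ` (carrier N \<times> carrier L \<times> carrier N),
     mult = rees_mult N L \<rho>,
     one = Inl \<one>\<^bsub>N\<^esub>\<rparr>"

definition local_rees :: "'a monoid \<Rightarrow> 'a monoid \<Rightarrow> 'a \<Rightarrow> ('a + ('a \<times> 'a \<times> 'a)) monoid"
  where "local_rees M N c =
    rees_extension N (local_divisor M c) (\<lambda>x. c \<otimes>\<^bsub>M\<^esub> x \<otimes>\<^bsub>M\<^esub> c)"

lemma local_divisor_carrier:
  "x \<in> carrier (local_divisor M c) \<longleftrightarrow>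
    (\<exists>n\<in>carrier M. x = c \<otimes>\<^bsub>M\<^esub> n) \<and> (\<exists>m\<in>carrier M. x = m \<otimes>\<^bsub>M\<^esub> c)"
  by (auto simp: local_divisor_def l_coset_def r_coset_def)

lemma local_divisor_mult:
  assumes "monoid M" "c \<in> carrier M" "m \<in> carrier M" "n \<in> carrier M"
  shows "(m \<otimes>\<^bsub>M\<^esub> c) \<otimes>\<^bsub>local_divisor M c\<^esub> (c \<otimes>\<^bsub>M\<^esub> n) = m \<otimes>\<^bsub>M\<^esub> c \<otimes>\<^bsub>M\<^esub> n"
proof -
  interpret monoid M by fact
  have eq: "m' \<otimes>\<^bsub>M\<^esub> c \<otimes>\<^bsub>M\<^esub> n' = m \<otimes>\<^bsub>M\<^esub> c \<otimes>\<^bsub>M\<^esub> n"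
    if "m' \<in> carrier M" "n' \<in> carrier M" "m \<otimes>\<^bsub>M\<^esub> c = m' \<otimes>\<^bsub>M\<^esub> c" "c \<otimes>\<^bsub>M\<^esub> n = c \<otimes>\<^bsub>M\<^esub> n'"
    for m' n'
  proof -
    have "m' \<otimes>\<^bsub>M\<^esub> c \<otimes>\<^bsub>M\<^esub> n' = m \<otimes>\<^bsub>M\<^esub> (c \<otimes>\<^bsub>M\<^esub> n')"
      unfolding that(3)[symmetric] using that(2) assms by (simp add: m_assoc)
    also have "\<dots> = m \<otimes>\<^bsub>M\<^esub> c \<otimes>\<^bsub>M\<^esub> n"
      unfolding that(4)[symmetric] using assms by (simp add: m_assoc)
    finally show ?thesis .
  qed
  have "(THE z. \<exists>m'\<in>carrier M. \<exists>n'\<in>carrier M.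
      m \<otimes>\<^bsub>M\<^esub> c = m' \<otimes>\<^bsub>M\<^esub> c \<and> c \<otimes>\<^bsub>M\<^esub> n = c \<otimes>\<^bsub>M\<^esub> n' \<and> z = m' \<otimes>\<^bsub>M\<^esub> c \<otimes>\<^bsub>M\<^esub> n')
    = m \<otimes>\<^bsub>M\<^esub> c \<otimes>\<^bsub>M\<^esub> n"
  proof (rule the_equality)
    show "\<exists>m'\<in>carrier M. \<exists>n'\<in>carrier M.
      m \<otimes>\<^bsub>M\<^esub> c = m' \<otimes>\<^bsub>M\<^esub> c \<and> c \<otimes>\<^bsub>M\<^esub> n = c \<otimes>\<^bsub>M\<^esub> n' \<and>
      m \<otimes>\<^bsub>M\<^esub> c \<otimes>\<^bsub>M\<^esub> n = m' \<otimes>\<^bsub>M\<^esub> c \<otimes>\<^bsub>M\<^esub> n'"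
      using assms(3,4) by blast
  qed (elim bexE conjE, simp only: eq)
  then show ?thesis
    by (simp only: local_divisor_def monoid.simps)
qed

lemma monoid_local_divisor:
  assumes "monoid M" and c: "c \<in> carrier M"
  shows "monoid (local_divisor M c)"
proof -
  interpret M: monoid M by fact
  let ?L = "local_divisor M c"
  have L: "\<exists>m\<in>carrier M. x = m \<otimes>\<^bsub>M\<^esub> c" "\<exists>n\<in>carrier M. x = c \<otimes>\<^bsub>M\<^esub> n"
    if "x \<in> carrier ?L" for x
    using that by (simp_all add: local_divisor_carrier)
  have mult: "x \<otimes>\<^bsub>?L\<^esub> (c \<otimes>\<^bsub>M\<^esub> n) = x \<otimes>\<^bsub>M\<^esub> n"
    if "x \<in> carrier ?L" "n \<in> carrier M" for x n
    using L(1)[OF that(1)] that(2) c local_divisor_mult[OF \<open>monoid M\<close>] by auto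
  have mult': "(m \<otimes>\<^bsub>M\<^esub> c) \<otimes>\<^bsub>?L\<^esub> y = m \<otimes>\<^bsub>M\<^esub> y"
    if "y \<in> carrier ?L" "m \<in> carrier M" for m y
    using L(2)[OF that(1)] that(2) c local_divisor_mult[OF \<open>monoid M\<close>]
    by (auto simp: M.m_assoc)
  have one: "\<one>\<^bsub>?L\<^esub> = c"
    by (simp add: local_divisor_def)
  have sub: "x \<in> carrier M" if "x \<in> carrier ?L" for x
    using L(1)[OF that] c by auto
  have closed: "x \<otimes>\<^bsub>?L\<^esub> y \<in> carrier ?L" if x: "x \<in> carrier ?L" and y: "y \<in> carrier ?L" for x y
  proof -
    obtain p q r s where pq: "p \<in> carrier M" "x = p \<otimes>\<^bsub>M\<^esub> c" "q \<in> carrier M" "x = c \<otimes>\<^bsub>M\<^esub> q"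
      and rs: "r \<in> carrier M" "y = r \<otimes>\<^bsub>M\<^esub> c" "s \<in> carrier M" "y = c \<otimes>\<^bsub>M\<^esub> s"
      using L[OF x] L[OF y] by blast
    have "x \<otimes>\<^bsub>?L\<^esub> y = c \<otimes>\<^bsub>M\<^esub> (q \<otimes>\<^bsub>M\<^esub> s)"
      using mult[OF x rs(3)] pq(3,4) rs(3,4) c by (simp add: M.m_assoc)
    moreover have "x \<otimes>\<^bsub>?L\<^esub> y = (p \<otimes>\<^bsub>M\<^esub> r) \<otimes>\<^bsub>M\<^esub> c"
      using mult'[OF y pq(1)] pq(1,2) rs(1,2) c by (simp add: M.m_assoc)
    ultimately show ?thesis
      using pq(1,3) rs(1,3) M.m_closed unfolding local_divisor_carrier by blast
  qed
  show ?thesis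
  proof (rule monoidI)
    show "\<one>\<^bsub>?L\<^esub> \<in> carrier ?L"
      unfolding one local_divisor_carrier
      using M.r_one[OF c, symmetric] M.l_one[OF c, symmetric] M.one_closed by blast
    show "x \<otimes>\<^bsub>?L\<^esub> y \<otimes>\<^bsub>?L\<^esub> z = x \<otimes>\<^bsub>?L\<^esub> (y \<otimes>\<^bsub>?L\<^esub> z)"
      if x: "x \<in> carrier ?L" and y: "y \<in> carrier ?L" and z: "z \<in> carrier ?L" for x y z
    proof -
      obtain p where p: "p \<in> carrier M" "x = p \<otimes>\<^bsub>M\<^esub> c" using L(1)[OF x] by blast
      obtain s where s: "s \<in> carrier M" "z = c \<otimes>\<^bsub>M\<^esub> s" using L(2)[OF z] by blast
      have "x \<otimes>\<^bsub>?L\<^esub> y \<otimes>\<^bsub>?L\<^esub> z = p \<otimes>\<^bsub>M\<^esub> y \<otimes>\<^bsub>M\<^esub> s"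
        using mult[OF closed[OF x y] s(1)] mult'[OF y p(1)] p s by simp
      also have "\<dots> = x \<otimes>\<^bsub>?L\<^esub> (y \<otimes>\<^bsub>?L\<^esub> z)"
        using mult'[OF closed[OF y z] p(1)] mult[OF y s(1)] p s sub[OF y]
        by (simp add: M.m_assoc)
      finally show ?thesis .
    qed
    show "\<one>\<^bsub>?L\<^esub> \<otimes>\<^bsub>?L\<^esub> x = x" if "x \<in> carrier ?L" for x
      using mult'[OF that M.one_closed] c sub[OF that] one by simp
    show "x \<otimes>\<^bsub>?L\<^esub> \<one>\<^bsub>?L\<^esub> = x" if "x \<in> carrier ?L" for x
      using mult[OF that M.one_closed] c sub[OF that] one by simp
  qed (rule closed)
qed

lemma monoid_rees_extension:
  assumes "monoid N" "monoid L" and \<rho>: "\<rho> \<in> carrier N \<rightarrow> carrier L"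
  shows "monoid (rees_extension N L \<rho>)"
proof -
  interpret N: monoid N by fact
  interpret L: monoid L by fact
  have [simp]: "\<rho> x \<in> carrier L" if "x \<in> carrier N" for x
    using \<rho> that by auto
  show ?thesis
    by (rule monoidI) (auto simp: rees_extension_def N.m_assoc L.m_assoc)
qed

end

theory Submission
  imports Defs
begin

text \<open>
  If \<open>M\<close> is not a group, choose a proper submonoid \<open>N\<close> that is maximal among those containing
  all units, and any \<open>c\<close> outside \<open>N\<close>. Multiplying out is a homomorphism from the local Rees
  product to \<open>M\<close>. Its image is a submonoid containing \<open>N\<close> and \<open>c\<close>, hence all of \<open>M\<close> by
  maximality. Both \<open>N\<close> and \<open>M\<^sub>c\<close> divide \<open>M\<close> and are smaller than \<open>M\<close> (\<open>M\<^sub>c\<close> misses the neutral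
  element of \<open>M\<close>), so induction on the order applies, with the length bound coming from
  \<open>(2 ^ (n - 1) - 1) + (2 ^ (n - 1) - 1) + 1 = 2 ^ n - 1\<close>.
\<close>

section \<open>Divisors and their transitivity\<close>

lemma is_divisor_iff:
  "is_divisor N M \<longleftrightarrow> (\<exists>S h. subsemigroup S M \<and> (\<forall>x\<in>S. h x \<in> carrier N) \<and>
    (\<forall>x\<in>S. \<forall>y\<in>S. h (x \<otimes>\<^bsub>M\<^esub> y) = h x \<otimes>\<^bsub>N\<^esub> h y) \<and> (\<forall>z\<in>carrier N. \<exists>x\<in>S. h x = z))"
proof -
  have "h \<in> epi (M\<lparr>carrier := S\<rparr>) N \<longleftrightarrow> (\<forall>x\<in>S. h x \<in> carrier N) \<and>
    (\<forall>x\<in>S. \<forall>y\<in>S. h (x \<otimes>\<^bsub>M\<^esub> y) = h x \<otimes>\<^bsub>N\<^esub> h y) \<and> (\<forall>z\<in>carrier N. \<exists>x\<in>S. h x = z)" for S h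
  proof -
    have "h ` S = carrier N \<longleftrightarrow> (\<forall>x\<in>S. h x \<in> carrier N) \<and> (\<forall>z\<in>carrier N. \<exists>x\<in>S. h x = z)"
      unfolding set_eq_subset image_subset_iff subset_iff[of "carrier N"] image_iff by metis
    then show ?thesis
      unfolding epi_def hom_def by (simp add: Pi_iff) blast
  qed
  then show ?thesis
    unfolding is_divisor_def by simp
qed

lemma is_divisorI:
  assumes "subsemigroup S M" "\<And>x. x \<in> S \<Longrightarrow> h x \<in> carrier N"
    "\<And>x y. x \<in> S \<Longrightarrow> y \<in> S \<Longrightarrow> h (x \<otimes>\<^bsub>M\<^esub> y) = h x \<otimes>\<^bsub>N\<^esub> h y"
    "\<And>z. z \<in> carrier N \<Longrightarrow> \<exists>x\<in>S. h x = z"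
  shows "is_divisor N M"
  unfolding is_divisor_iff using assms by blast

text \<open>The witness is the preimage of \<open>T\<close> under \<open>h\<close> inside
  \<open>S\<close>, mapped by \<open>g\<close> after \<open>h\<close>. Since \<open>h\<close> is
  onto (\<open>lift\<close>), this preimage is nonempty and the composite is still onto.\<close>

lemma is_divisor_trans:
  assumes "is_divisor P N" "is_divisor N M"
  shows "is_divisor P M"
proof -
  obtain S h where S: "subsemigroup S M" "\<forall>x\<in>S. h x \<in> carrier N"
    "\<forall>x\<in>S. \<forall>y\<in>S. h (x \<otimes>\<^bsub>M\<^esub> y) = h x \<otimes>\<^bsub>N\<^esub> h y" "\<forall>z\<in>carrier N. \<exists>x\<in>S. h x = z"
    using assms(2) unfolding is_divisor_iff by blast
  obtain T g where T: "subsemigroup T N" "\<forall>x\<in>T. g x \<in> carrier P"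
    "\<forall>x\<in>T. \<forall>y\<in>T. g (x \<otimes>\<^bsub>N\<^esub> y) = g x \<otimes>\<^bsub>P\<^esub> g y" "\<forall>z\<in>carrier P. \<exists>x\<in>T. g x = z"
    using assms(1) unfolding is_divisor_iff by blast
  have lift: "\<exists>x\<in>S. h x = t" if "t \<in> T" for t
    using that S(4) T(1) by (auto simp: subsemigroup_def)
  show ?thesis
  proof (rule is_divisorI[of "{x \<in> S. h x \<in> T}" M "\<lambda>x. g (h x)"])
    have "{x \<in> S. h x \<in> T} \<noteq> {}"
      using lift T(1) by (fastforce simp: subsemigroup_def)
    then show "subsemigroup {x \<in> S. h x \<in> T} M"
      using S(1,3) T(1) by (auto simp: subsemigroup_def)
    show "\<exists>x\<in>{x \<in> S. h x \<in> T}. g (h x) = z" if "z \<in> carrier P" for z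
      using T(4) that lift by fastforce
  qed (use S(3) T(2,3) in auto)
qed

lemma is_divisor_submonoid:
  assumes "submonoid H M"
  shows "is_divisor (M\<lparr>carrier := H\<rparr>) M"
proof -
  interpret submonoid H M by fact
  show ?thesis
    using subset one_closed empty_iff
    by (intro is_divisorI[of H M id]) (auto simp: subsemigroup_def simp del: one_closed)
qed

section \<open>The local divisor as a smaller divisor\<close>

lemma local_divisorE:
  assumes "x \<in> carrier (local_divisor M c)"
  obtains m n where "m \<in> carrier M" "x = m \<otimes>\<^bsub>M\<^esub> c" "n \<in> carrier M" "x = c \<otimes>\<^bsub>M\<^esub> n"
  using assms unfolding local_divisor_carrier by blast

lemma local_divisor_subset:
  assumes "monoid M" "c \<in> carrier M"
  shows "carrier (local_divisor M c) \<subseteq> carrier M"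
  using assms by (auto elim!: local_divisorE intro: monoid.m_closed)

text \<open>The surjection is left multiplication by \<open>c\<close>, restricted to those
  \<open>x\<close> for which \<open>c x\<close> lies in \<open>M_c\<close>. If
  \<open>c x = p c\<close>, then \<open>(c x) \<circ> (c y) = p c y = c x y\<close>. It is onto
  because every element of \<open>M_c\<close> has the form \<open>c n\<close>.\<close>

lemma is_divisor_local_divisor:
  assumes "monoid M" and c: "c \<in> carrier M"
  shows "is_divisor (local_divisor M c) M"
proof -
  interpret monoid M by fact
  let ?S = "{x \<in> carrier M. c \<otimes>\<^bsub>M\<^esub> x \<in> carrier (local_divisor M c)}"
  have mult: "c \<otimes>\<^bsub>M\<^esub> (x \<otimes>\<^bsub>M\<^esub> y) = (c \<otimes>\<^bsub>M\<^esub> x) \<otimes>\<^bsub>local_divisor M c\<^esub> (c \<otimes>\<^bsub>M\<^esub> y)"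
    if x: "x \<in> ?S" and y: "y \<in> ?S" for x y
  proof -
    obtain p where "p \<in> carrier M" "c \<otimes>\<^bsub>M\<^esub> x = p \<otimes>\<^bsub>M\<^esub> c"
      using x unfolding mem_Collect_eq by (blast elim: local_divisorE)
    then show ?thesis
      using local_divisor_mult[OF assms, of p y] x y c by (simp flip: m_assoc)
  qed
  interpret L: monoid "local_divisor M c"
    using assms by (rule monoid_local_divisor)
  have "\<one>\<^bsub>M\<^esub> \<in> ?S"
    using L.one_closed c by (simp add: local_divisor_def)
  moreover have "x \<otimes>\<^bsub>M\<^esub> y \<in> ?S" if "x \<in> ?S" "y \<in> ?S" for x y
    using mult[OF that] that by simp
  ultimately have S: "subsemigroup ?S M"
    unfolding subsemigroup_def by blast
  show ?thesis
  proof (rule is_divisorI[OF S, of "\<lambda>x. c \<otimes>\<^bsub>M\<^esub> x"])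
    show "\<exists>x\<in>?S. c \<otimes>\<^bsub>M\<^esub> x = z" if "z \<in> carrier (local_divisor M c)" for z
      using that local_divisor_subset[OF assms] unfolding local_divisor_carrier by auto
  qed (use mult in auto)
qed

lemma card_local_divisor_less:
  assumes "monoid M" "finite (carrier M)" "c \<in> carrier M" "c \<notin> Units M"
  shows "card (carrier (local_divisor M c)) < card (carrier M)"
proof (rule psubset_card_mono)
  interpret monoid M by fact
  have "\<one>\<^bsub>M\<^esub> \<notin> carrier (local_divisor M c)"
  proof
    assume "\<one>\<^bsub>M\<^esub> \<in> carrier (local_divisor M c)"
    then obtain m n where mn: "m \<in> carrier M" "\<one>\<^bsub>M\<^esub> = m \<otimes>\<^bsub>M\<^esub> c" "n \<in> carrier M" "\<one>\<^bsub>M\<^esub> = c \<otimes>\<^bsub>M\<^esub> n"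
      by (rule local_divisorE)
    \<comment> \<open>A left inverse and a right inverse of \<open>c\<close> coincide, so
      \<open>c\<close> would be a unit.\<close>
    have "m = n"
      by (rule inv_unique[OF mn(2)[symmetric] mn(4)[symmetric] assms(3) mn(1) mn(3)])
    then have "\<exists>m\<in>carrier M. m \<otimes>\<^bsub>M\<^esub> c = \<one>\<^bsub>M\<^esub> \<and> c \<otimes>\<^bsub>M\<^esub> m = \<one>\<^bsub>M\<^esub>"
      using mn(1) mn(2)[symmetric] mn(4)[symmetric] by blast
    then show False
      using assms(3,4) unfolding Units_def by blast
  qed
  then show "carrier (local_divisor M c) \<subset> carrier M"
    using local_divisor_subset[OF assms(1,3)] one_closed by blast
qed (use assms in simp)

section \<open>Multiplying out the local Rees product\<close>

fun rees_eval :: "'a monoid \<Rightarrow> 'a + ('a \<times> 'a \<times> 'a) \<Rightarrow> 'a"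
  where
    "rees_eval M (Inl n) = n"
  | "rees_eval M (Inr (n1, m, n2)) = n1 \<otimes>\<^bsub>M\<^esub> m \<otimes>\<^bsub>M\<^esub> n2"

text \<open>This is why the Rees product uses \<open>x \<mapsto> c x c\<close>. With
  \<open>m = p c\<close> and \<open>m' = c q\<close>, each of the two products in \<open>M_c\<close>
  merges two adjacent copies of \<open>c\<close> into one, so a product of triples evaluates to the
  product of their values.\<close>

lemma local_divisor_sandwich:
  assumes "monoid M" and c: "c \<in> carrier M" and x: "x \<in> carrier M"
    and m: "m \<in> carrier (local_divisor M c)" and m': "m' \<in> carrier (local_divisor M c)"
  shows "m \<otimes>\<^bsub>local_divisor M c\<^esub> (c \<otimes>\<^bsub>M\<^esub> x \<otimes>\<^bsub>M\<^esub> c) \<otimes>\<^bsub>local_divisor M c\<^esub> m' = m \<otimes>\<^bsub>M\<^esub> x \<otimes>\<^bsub>M\<^esub> m'"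
proof -
  interpret monoid M by fact
  note mult = local_divisor_mult[OF \<open>monoid M\<close> c]
  obtain p where p: "p \<in> carrier M" "m = p \<otimes>\<^bsub>M\<^esub> c"
    using m by (auto simp: local_divisor_carrier)
  obtain q where q: "q \<in> carrier M" "m' = c \<otimes>\<^bsub>M\<^esub> q"
    using m' by (auto simp: local_divisor_carrier)
  have "m \<otimes>\<^bsub>local_divisor M c\<^esub> (c \<otimes>\<^bsub>M\<^esub> x \<otimes>\<^bsub>M\<^esub> c) = (m \<otimes>\<^bsub>M\<^esub> x) \<otimes>\<^bsub>M\<^esub> c"
    using mult[of p "x \<otimes>\<^bsub>M\<^esub> c"] p c x by (simp add: m_assoc)
  then show ?thesis
    using mult[of "m \<otimes>\<^bsub>M\<^esub> x" q] p q c x by (simp add: m_assoc)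
qed

lemma rees_eval_mult:
  assumes "monoid M" and c: "c \<in> carrier M" and H: "submonoid H M"
    and x: "x \<in> carrier (local_rees M (M\<lparr>carrier := H\<rparr>) c)"
    and y: "y \<in> carrier (local_rees M (M\<lparr>carrier := H\<rparr>) c)"
  shows "rees_eval M (x \<otimes>\<^bsub>local_rees M (M\<lparr>carrier := H\<rparr>) c\<^esub> y) = rees_eval M x \<otimes>\<^bsub>M\<^esub> rees_eval M y"
proof -
  interpret monoid M by fact
  interpret H: submonoid H M by fact
  note [simp] = local_divisor_subset[OF \<open>monoid M\<close> c, THEN subsetD]
  have sandwich: "m \<otimes>\<^bsub>local_divisor M c\<^esub> (c \<otimes>\<^bsub>M\<^esub> x \<otimes>\<^bsub>M\<^esub> c) \<otimes>\<^bsub>local_divisor M c\<^esub> m' = m \<otimes>\<^bsub>M\<^esub> (x \<otimes>\<^bsub>M\<^esub> m')"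
    if "x \<in> H" "m \<in> carrier (local_divisor M c)" "m' \<in> carrier (local_divisor M c)" for x m m'
    using local_divisor_sandwich[OF \<open>monoid M\<close> c H.mem_carrier[OF that(1)] that(2,3)]
      m_assoc[of m x m'] that by simp
  show ?thesis
    \<comment> \<open>Associativity waits for the second pass: it would rebracket
      \<open>c x c\<close> and hide the left-hand side of \<open>sandwich\<close>.\<close>
    using x y by (auto simp: local_rees_def rees_extension_def sandwich) (auto simp: m_assoc)
qed

lemma local_rees_divisor_of_maximal:
  assumes "monoid M" and c: "c \<in> carrier M" and "c \<notin> H" and H: "submonoid H M"
    and maximal: "\<And>K. submonoid K M \<Longrightarrow> H \<subset> K \<Longrightarrow> K = carrier M"
  shows "is_divisor M (local_rees M (M\<lparr>carrier := H\<rparr>) c)"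
proof -
  interpret M: monoid M by fact
  interpret H: submonoid H M by fact
  interpret L: monoid "local_divisor M c"
    using \<open>monoid M\<close> c by (rule monoid_local_divisor)
  let ?R = "local_rees M (M\<lparr>carrier := H\<rparr>) c"
  \<comment> \<open>Reading \<open>c x c\<close> as \<open>c (x c)\<close> and as
    \<open>(c x) c\<close> puts it into both \<open>c M\<close> and \<open>M c\<close>. The Rees
    product is a monoid only once this map into \<open>M_c\<close> is known to be well
    defined.\<close>
  have range: "c \<otimes>\<^bsub>M\<^esub> x \<otimes>\<^bsub>M\<^esub> c \<in> carrier (local_divisor M c)" if "x \<in> H" for x
    unfolding local_divisor_carrier
    using that c M.m_assoc[of c x c] M.m_closed H.mem_carrier by metis
  have "monoid ?R"
    unfolding local_rees_def
    using H.submonoid_is_monoid[OF \<open>monoid M\<close>] L.monoid_axioms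
    by (rule monoid_rees_extension) (use range in auto)
  then interpret R: monoid ?R .
  note mult = rees_eval_mult[OF \<open>monoid M\<close> c H]
  let ?K = "rees_eval M ` carrier ?R"
  have sub: "rees_eval M x \<in> carrier M" if "x \<in> carrier ?R" for x
    using that local_divisor_subset[OF \<open>monoid M\<close> c]
    by (auto simp: local_rees_def rees_extension_def)
  have HK: "H \<subseteq> ?K"
  proof
    fix h assume "h \<in> H"
    then show "h \<in> ?K"
      by (intro image_eqI[of _ _ "Inl h"]) (auto simp: local_rees_def rees_extension_def)
  qed
  \<comment> \<open>As the neutral element of \<open>M_c\<close>, \<open>c\<close> may be the middle
    entry of a triple, and \<open>(1, c, 1)\<close> evaluates to \<open>c\<close>.\<close>
  have "c \<in> ?K"
    using c L.one_closed
    by (intro image_eqI[of _ _ "Inr (\<one>\<^bsub>M\<^esub>, c, \<one>\<^bsub>M\<^esub>)"])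
      (auto simp: local_rees_def rees_extension_def local_divisor_def)
  have "submonoid ?K M"
  proof (rule submonoid.intro)
    show "\<one>\<^bsub>M\<^esub> \<in> ?K"
      using HK by auto
    show "a \<otimes>\<^bsub>M\<^esub> b \<in> ?K" if a: "a \<in> ?K" and b: "b \<in> ?K" for a b
    proof -
      obtain x y where "x \<in> carrier ?R" "y \<in> carrier ?R" "a = rees_eval M x" "b = rees_eval M y"
        using a b by blast
      then show ?thesis
        using mult[of x y] R.m_closed[of x y] by (metis imageI)
    qed
  qed (use sub in auto)
  then have K: "?K = carrier M"
    using maximal HK \<open>c \<in> ?K\<close> \<open>c \<notin> H\<close> by blast
  show ?thesis
  proof (rule is_divisorI[where S = "carrier ?R" and h = "rees_eval M"])
    show "subsemigroup (carrier ?R) ?R"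
      using R.one_closed by (auto simp: subsemigroup_def simp del: R.one_closed)
    show "\<exists>x\<in>carrier ?R. rees_eval M x = z" if "z \<in> carrier M" for z
      using that unfolding K[symmetric] by blast
    show "rees_eval M x \<in> carrier M" if "x \<in> carrier ?R" for x
      using that by (rule sub)
    show "rees_eval M (x \<otimes>\<^bsub>?R\<^esub> y) = rees_eval M x \<otimes>\<^bsub>M\<^esub> rees_eval M y"
      if "x \<in> carrier ?R" "y \<in> carrier ?R" for x y
      using that by (rule mult)
  qed
qed

section \<open>Building the sequence by induction on the order\<close>

text \<open>The parameter \<open>T\<close> is separate from the sequence because the induction
  passes to smaller monoids, while the groups must divide the original one.\<close>

definition decomposition_step :: "'a monoid \<Rightarrow> (nat \<Rightarrow> 'a monoid) \<Rightarrow> nat \<Rightarrow> bool"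
  where "decomposition_step T Ms j \<longleftrightarrow> monoid (Ms j) \<and>
    ((group (Ms j) \<and> is_divisor (Ms j) T) \<or>
     (\<exists>i\<in>{1..<j}. \<exists>l\<in>{1..<j}. \<exists>c\<in>carrier (Ms j) - Units (Ms j).
        proper_submonoid (Ms i) (Ms j) \<and>
        Ms l = local_divisor (Ms j) c \<and>
        is_divisor (Ms j) (local_rees (Ms j) (Ms i) c)))"

text \<open>A step looks only at the terms with indices from \<open>1\<close> to \<open>j\<close>,
  so it survives moving the sequence by an offset \<open>d\<close>. This allows sequences to be
  concatenated.\<close>

lemma decomposition_step_shift:
  assumes "decomposition_step T Ms j" "\<And>i. i \<in> {1..j} \<Longrightarrow> Ns (i + d) = Ms i" "1 \<le> j"
  shows "decomposition_step T Ns (j + d)"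
proof -
  have shift: "i + d \<in> {1..<j + d} \<and> Ns (i + d) = Ms i" if "i \<in> {1..<j}" for i
    using that assms(2)[of i] by auto
  have "Ns (j + d) = Ms j"
    using assms(2)[of j] assms(3) by simp
  then show ?thesis
    using assms(1) unfolding decomposition_step_def by (metis shift)
qed

text \<open>Dividing the fixed \<open>T\<close> is the invariant of the induction: \<open>N\<close>
  and \<open>M_c\<close> divide \<open>M\<close>, hence \<open>T\<close> by transitivity.\<close>

lemma decomposition_exists:
  fixes M T :: "'a monoid"
  assumes "monoid M" "finite (carrier M)" "is_divisor M T"
  shows "\<exists>k Ms. 1 \<le> k \<and> k \<le> 2 ^ order M - 1 \<and> Ms k = M \<and>
    (\<forall>j\<in>{1..k}. decomposition_step T Ms j)"
  using assms
proof (induction "order M" arbitrary: M rule: less_induct)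
  case less
  interpret monoid M by fact
  have pos: "0 < order M"
    using less.prems(2) one_closed by (auto simp: order_def card_gt_0_iff)
  show ?case
  proof (cases "group M")
    case True
    have "(1::nat) \<le> 2 ^ order M - 1"
      using power_increasing[of 1 "order M" "2::nat"] pos by simp
    then show ?thesis
      using True less.prems
      by (intro exI[of _ 1] exI[of _ "\<lambda>_. M"]) (auto simp: decomposition_step_def)
  next
    case False
    have "Units M \<noteq> carrier M"
      using False monoid_axioms by (auto simp: group_def group_axioms_def)
    \<comment> \<open>The units form a member of \<open>?P\<close> because \<open>M\<close> is not a
      group, and finiteness gives a maximal member \<open>H\<close> above them. Any \<open>c\<close>
      outside \<open>H\<close> is then a non-unit.\<close>
    let ?P = "{K. submonoid K M \<and> K \<noteq> carrier M}"
    have "?P \<subseteq> Pow (carrier M)"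
      using submonoid.subset by auto
    then have "finite ?P"
      using less.prems(2) finite_subset by blast
    moreover have "Units M \<in> ?P"
      using \<open>Units M \<noteq> carrier M\<close> by (auto intro: submonoid.intro)
    ultimately obtain H where H: "H \<in> ?P" "Units M \<subseteq> H"
      and max: "\<And>K. K \<in> ?P \<Longrightarrow> H \<subseteq> K \<Longrightarrow> K = H"
      using finite_has_maximal2[of ?P "Units M"] by (metis (no_types, lifting))
    have sub: "H \<subset> carrier M"
      using H(1) submonoid.subset by blast
    then obtain c where c: "c \<in> carrier M" "c \<notin> H" by blast
    let ?N = "M\<lparr>carrier := H\<rparr>" and ?L = "local_divisor M c"
    have "is_divisor M (local_rees M ?N c)"
      using less.prems(1) c H(1) max by (intro local_rees_divisor_of_maximal) auto
    have N: "monoid ?N" "finite (carrier ?N)" "is_divisor ?N T" "order ?N < order M"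
      using H(1) sub less.prems(1,2) submonoid.submonoid_is_monoid
        is_divisor_trans[OF is_divisor_submonoid less.prems(3)]
      by (auto simp: order_def psubset_card_mono intro: finite_subset)
    have "c \<notin> Units M"
      using c(2) H(2) by blast
    then have L: "monoid ?L" "finite (carrier ?L)" "is_divisor ?L T" "order ?L < order M"
      using monoid_local_divisor[OF less.prems(1) c(1)]
        is_divisor_trans[OF is_divisor_local_divisor less.prems(3)]
        card_local_divisor_less[OF less.prems(1,2) c(1)]
        finite_subset[OF local_divisor_subset less.prems(2)] less.prems(1) c(1)
      by (auto simp: order_def)
    obtain k1 Ms1 where 1: "1 \<le> k1" "k1 \<le> 2 ^ order ?N - 1" "Ms1 k1 = ?N"
      "\<forall>j\<in>{1..k1}. decomposition_step T Ms1 j"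
      using less.hyps[OF N(4) N(1-3)] by blast
    obtain k2 Ms2 where 2: "1 \<le> k2" "k2 \<le> 2 ^ order ?L - 1" "Ms2 k2 = ?L"
      "\<forall>j\<in>{1..k2}. decomposition_step T Ms2 j"
      using less.hyps[OF L(4) L(1-3)] by blast
    \<comment> \<open>The sequence ending in \<open>N\<close>, then the one ending in
      \<open>M_c\<close> with offset \<open>k1\<close>, then \<open>M\<close> itself.\<close>
    define Ms where "Ms = (\<lambda>j. if j \<le> k1 then Ms1 j else if j \<le> k1 + k2 then Ms2 (j - k1) else M)"
    let ?k = "Suc (k1 + k2)"
    have step: "decomposition_step T Ms j" if "j \<in> {1..?k}" for j
    proof -
      consider "j \<in> {1..k1}" | i where "i \<in> {1..k2}" "j = i + k1" | "j = ?k"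
      proof -
        have "j \<in> {1..k1} \<or> (j - k1 \<in> {1..k2} \<and> j = (j - k1) + k1) \<or> j = ?k"
          using \<open>j \<in> {1..?k}\<close> by auto
        then show thesis
          using that by blast
      qed
      then show ?thesis
      proof cases
        case 1
        then show ?thesis
          using decomposition_step_shift[of T Ms1 j Ms 0] \<open>\<forall>j\<in>{1..k1}. _ j\<close> by (simp add: Ms_def)
      next
        case 2
        then show ?thesis
          using decomposition_step_shift[of T Ms2 i Ms k1] \<open>\<forall>j\<in>{1..k2}. _ j\<close> by (simp add: Ms_def)
      next
        case 3
        \<comment> \<open>The witnesses for the last term are \<open>i = k1\<close> and
          \<open>l = k1 + k2\<close>, the ends of the two blocks. As \<open>1 \<le> k2\<close>, the
          index \<open>k1 + k2\<close> really falls into the second block.\<close>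
        have "Ms j = M" "Ms k1 = ?N" "Ms (k1 + k2) = ?L"
          using 3 1(3) 2(1,3) by (auto simp: Ms_def)
        moreover have "k1 \<in> {1..<j}" "k1 + k2 \<in> {1..<j}" "c \<in> carrier M - Units M"
          using 3 1(1) c H(2) by auto
        moreover have "proper_submonoid ?N M"
          using H(1) by (auto simp: proper_submonoid_def)
        ultimately show ?thesis
          using \<open>is_divisor M (local_rees M ?N c)\<close> less.prems(1)
          unfolding decomposition_step_def by metis
      qed
    qed
    have "2 ^ order ?N \<le> (2::nat) ^ (order M - 1)" "2 ^ order ?L \<le> (2::nat) ^ (order M - 1)"
      using N(4) L(4) by (auto intro!: power_increasing)
    \<comment> \<open>Positivity of the order keeps the subtraction in the exponent from being
      truncated.\<close>
    moreover have "2 ^ order M = 2 * (2::nat) ^ (order M - 1)"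
      using pos by (simp flip: power_Suc)
    ultimately have "?k \<le> 2 ^ order M - 1"
      using 1(1,2) 2(1,2) by linarith
    then show ?thesis
      using step by (intro exI[of _ ?k] exI[of _ Ms]) (auto simp: Ms_def)
  qed
qed

theorem proposition13:
  fixes M :: "'a monoid"
  assumes "monoid M" and "finite (carrier M)"
  shows "\<exists>(k::nat) (Ms :: nat \<Rightarrow> 'a monoid).
    1 \<le> k \<and> k \<le> 2 ^ order M - 1 \<and> Ms k = M \<and>
    (\<forall>j\<in>{1..k}. monoid (Ms j) \<and>
      ((group (Ms j) \<and> is_divisor (Ms j) M) \<or>
       (\<exists>i\<in>{1..<j}. \<exists>l\<in>{1..<j}. \<exists>c\<in>carrier (Ms j) - Units (Ms j).
          proper_submonoid (Ms i) (Ms j) \<and>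
          Ms l = local_divisor (Ms j) c \<and>
          is_divisor (Ms j) (local_rees (Ms j) (Ms i) c))))"
proof -
  interpret monoid M by fact
  \<comment> \<open>The induction starts with \<open>T = M\<close>.\<close>
  have "is_divisor M M"
    using is_divisor_submonoid[of "carrier M" M] by (simp add: submonoid.intro)
  then show ?thesis
    using decomposition_exists[OF assms] unfolding decomposition_step_def by blast
qed

end
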